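(* For fixed integers $d$ and $k$ with $2\leq k\leq d$, as $n\to\infty$, we have $$a(d,k,n)\leq O\left(n^{\frac{d}{2\lfloor (k+2)/4\rfloor}\left(1-\frac{1}{2\lfloor(k+2)/4\rfloor d+1}\right)}\right),$$ where the implied constant depends only on $d$ and $k$.
   Context: For a positive integer $n$, $[n]=\{1,\dots,n\}$. A $k$-flat is a $k$-dimensional affine subspace of $\mathbb{R}^d$. $a(d,k,n)$ denotes the maximum number of points that can be selected from the grid $[n]^d\subset\mathbb{R}^d$ such that no $k+2$ of the selected points lie on a common $k$-flat. *)

theory Defs
  imports "HOL-Analysis.Analysis" "HOL-Library.Landau_Symbols"
begin

definition grid :: "nat \<Rightarrow> (real ^ 'd) set" where
  "grid n = {x. \<forall>i. \<exists>m\<in>{1..n}. x $ i = real m}"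

definition flat :: "nat \<Rightarrow> (real ^ 'd) set \<Rightarrow> bool" where
  "flat k F \<longleftrightarrow> affine F \<and> aff_dim F = int k"

(* card T = k + 2 > 0 forces T to be finite, so T ranges over the sets of k + 2 distinct
   points of S. *)
definition no_k_plus_2_on_flat :: "nat \<Rightarrow> (real ^ 'd) set \<Rightarrow> bool" where
  "no_k_plus_2_on_flat k S \<longleftrightarrow> \<not> (\<exists>F T. flat k F \<and> T \<subseteq> S \<and> card T = k + 2 \<and> T \<subseteq> F)"

(* a(d,k,n) with d = CARD('d); the type argument only carries the dimension. The set under Max
   is finite and nonempty, see a_num_attained below. *)
definition a_num :: "'d::finite itself \<Rightarrow> nat \<Rightarrow> nat \<Rightarrow> nat" where
  "a_num _ k n = Max {card S |S :: (real ^ 'd) set. S \<subseteq> grid n \<and> no_k_plus_2_on_flat k S}"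

lemma finite_grid: "finite (grid n :: (real ^ 'd::finite) set)"
proof -
  have "grid n \<subseteq> vec_lambda ` (PiE (UNIV :: 'd set) (\<lambda>_. real ` {1..n}))"
  proof
    fix x :: "real ^ 'd"
    assume "x \<in> grid n"
    then have "vec_nth x \<in> PiE UNIV (\<lambda>_. real ` {1..n})"
      by (auto simp: grid_def)
    then have "vec_lambda (vec_nth x) \<in> vec_lambda ` (PiE UNIV (\<lambda>_. real ` {1..n}))"
      by (rule imageI)
    then show "x \<in> vec_lambda ` (PiE UNIV (\<lambda>_. real ` {1..n}))"
      by simp
  qed
  then show ?thesis
    by (rule finite_subset) (intro finite_imageI finite_PiE; simp)
qed

lemma a_num_attained:
  "a_num TYPE('d::finite) k n \<in>
    {card S |S :: (real ^ 'd) set. S \<subseteq> grid n \<and> no_k_plus_2_on_flat k S}" (is "_ \<in> ?C")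
proof -
  have "?C \<subseteq> card ` Pow (grid n :: (real ^ 'd) set)"
    by auto
  then have "finite ?C"
    by (rule finite_subset) (simp add: finite_grid)
  moreover have "no_k_plus_2_on_flat k ({} :: (real ^ 'd) set)"
    by (auto simp: no_k_plus_2_on_flat_def)
  then have "?C \<noteq> {}"
    by blast
  ultimately show ?thesis
    unfolding a_num_def by (rule Max_in)
qed

end

theory Submission
  imports Defs "HOL-Number_Theory.Cong"
begin

text \<open>
  Put \<open>r = (k + 2) div 4\<close> and let \<open>S\<close> be a set of \<open>N\<close> points of the grid of side \<open>n\<close> in dimension \<open>d\<close>
  without \<open>k + 2\<close> points on a \<open>k\<close>-flat. If \<open>N\<close> is not bounded by a constant, then any \<open>4 * r\<close> points
  of \<open>S\<close> are affinely independent (\<open>affine_independent_if_no_k_plus_2_on_flat\<close>). Consequently, for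
  disjoint \<open>r\<close>-subsets \<open>X\<close> and \<open>Y\<close> of \<open>S\<close>, the difference of the sum of \<open>X\<close> and the sum of \<open>Y\<close>
  determines the pair \<open>(X, Y)\<close>, and the differences of distinct pairs are never positive multiples
  of one another (\<open>eq_if_proportional_sum_differences\<close>).

  Counting all the differences in their box of volume \<open>O(n ^ d)\<close> would only use that they are distinct,
  and give \<open>N ^ (2 * r) = O(n ^ d)\<close>. Their not being proportional yields more. For a modulus \<open>q\<close> consider
  the pairs whose difference is divisible by \<open>q\<close>, and divide the difference by \<open>q\<close>. About
  \<open>N ^ (2 * r) / q ^ d\<close> pairs have this property, and the quotients lie in a box whose volume is also
  smaller by the factor \<open>q ^ d\<close>. But the quotients for different moduli are distinct too, so all the
  moduli between \<open>Q\<close> and \<open>2 * Q\<close> share one box, and \<open>Q * N ^ (2 * r) = O(n ^ d)\<close>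
  (\<open>card_times_multipliers_le\<close>).

  How large \<open>Q\<close> may be is decided by the lower bound for the number of disjoint pairs with congruent
  sums (\<open>card_disjoint_cong_pairs_ge\<close>). The pigeonhole principle bounds the number of all congruent
  pairs from below, and overlapping pairs are a minority as long as \<open>q ^ d\<close> is at most a small
  constant times \<open>N\<close>. So \<open>Q\<close> can be taken of order \<open>N powr (1 / d)\<close>, which gives
  \<open>N powr (2 * r + 1 / d) = O(n ^ d)\<close> (\<open>card_powr_le\<close>). The exponent \<open>d / (2 * r + 1 / d)\<close> that
  results for \<open>N\<close> is the claimed one.
\<close>

section \<open>Pairs of subsets with congruent sums\<close>

text \<open>
  The class sizes of the partition of \<open>A\<close> by the value of \<open>f\<close> sum to \<open>card A\<close>, and their squares
  sum to the number of collisions; Cauchy--Schwarz compares the two sums.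
\<close>

lemma card_sq_le_card_collisions:
  assumes "finite A" "finite R" "f ` A \<subseteq> R"
  shows "(card A)\<^sup>2 \<le> card R * card {(a, b). a \<in> A \<and> b \<in> A \<and> f a = f b}"
proof -
  define C where "C c = {a \<in> A. f a = c}" for c
  have fin: "finite (C c)" for c using assms by (auto simp: C_def)
  have A: "card A = (\<Sum>c\<in>R. card (C c))"
  proof -
    have "A = (\<Union>c\<in>R. C c)" using assms(3) by (auto simp: C_def)
    then have "card A = card (\<Union>c\<in>R. C c)" by simp
    also have "\<dots> = (\<Sum>c\<in>R. card (C c))"
      by (rule card_UN_disjoint) (use assms fin in \<open>auto simp: C_def\<close>)
    finally show ?thesis .
  qed
  have P: "card {(a, b). a \<in> A \<and> b \<in> A \<and> f a = f b} = (\<Sum>c\<in>R. (card (C c))\<^sup>2)"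
  proof -
    have "{(a, b). a \<in> A \<and> b \<in> A \<and> f a = f b} = (\<Union>c\<in>R. C c \<times> C c)"
      using assms(3) by (auto simp: C_def)
    then have "card {(a, b). a \<in> A \<and> b \<in> A \<and> f a = f b} = card (\<Union>c\<in>R. C c \<times> C c)" by simp
    also have "\<dots> = (\<Sum>c\<in>R. card (C c \<times> C c))"
      by (rule card_UN_disjoint) (use assms fin in \<open>auto simp: C_def\<close>)
    finally show ?thesis by (simp add: card_cartesian_product power2_eq_square)
  qed
  have "real ((card A)\<^sup>2) \<le> real (card R * (\<Sum>c\<in>R. (card (C c))\<^sup>2))"
    using sum_squared_le_sum_of_squares[of "\<lambda>c. real (card (C c))" R]
    by (simp add: A mult.commute)
  then show ?thesis unfolding P of_nat_le_iff .
qed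

text \<open>
  The function \<open>w\<close> gives the integer coordinates of a point. Pairs of sets are used in place of
  pairs of tuples, so that a pair can be recovered from the coefficients of its difference of sums.
\<close>

definition cong_pairs :: "('a \<Rightarrow> 'i \<Rightarrow> int) \<Rightarrow> nat \<Rightarrow> 'a set \<Rightarrow> nat \<Rightarrow> ('a set \<times> 'a set) set" where
  "cong_pairs w q S r = {(X, Y). X \<subseteq> S \<and> Y \<subseteq> S \<and> card X = r \<and> card Y = r \<and>
     (\<forall>i. [(\<Sum>x\<in>X. w x i) = (\<Sum>y\<in>Y. w y i)] (mod int q))}"

text \<open>
  Only disjoint pairs are useful for geometry: a common point contributes nothing to the difference
  of the two sums, so different overlapping pairs may well have the same difference.
\<close>

definition disjoint_cong_pairs :: "('a \<Rightarrow> 'i \<Rightarrow> int) \<Rightarrow> nat \<Rightarrow> 'a set \<Rightarrow> nat \<Rightarrow> ('a set \<times> 'a set) set" where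
  "disjoint_cong_pairs w q S r = {(X, Y) \<in> cong_pairs w q S r. X \<inter> Y = {}}"

lemma finite_cong_pairs: "finite S \<Longrightarrow> finite (cong_pairs w q S r)"
  by (rule finite_subset[of _ "Pow S \<times> Pow S"]) (auto simp: cong_pairs_def)

lemma finite_disjoint_cong_pairs: "finite S \<Longrightarrow> finite (disjoint_cong_pairs w q S r)"
  by (rule finite_subset[OF _ finite_cong_pairs]) (auto simp: disjoint_cong_pairs_def)

lemma card_sq_le_residue_collisions:
  fixes v :: "'b \<Rightarrow> 'i::finite \<Rightarrow> int"
  assumes "finite A" "q > 0"
  shows "(card A)\<^sup>2 \<le> q ^ CARD('i) * card {(a, b). a \<in> A \<and> b \<in> A \<and> (\<forall>i. [v a i = v b i] (mod int q))}"
proof -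
  define f where "f a = (\<lambda>i. v a i mod int q)" for a
  define R where "R = (PiE UNIV (\<lambda>_. {0..<int q}) :: ('i \<Rightarrow> int) set)"
  have "(card A)\<^sup>2 \<le> card R * card {(a, b). a \<in> A \<and> b \<in> A \<and> f a = f b}"
    by (rule card_sq_le_card_collisions) (use assms in \<open>auto simp: R_def f_def finite_PiE\<close>)
  moreover have "card R = q ^ CARD('i)" by (simp add: R_def card_PiE)
  ultimately show ?thesis by (simp add: f_def cong_def fun_eq_iff)
qed

lemma card_cong_pairs_ge:
  fixes w :: "'a \<Rightarrow> 'i::finite \<Rightarrow> int"
  assumes "finite S" "q > 0"
  shows "(card S choose r)\<^sup>2 \<le> q ^ CARD('i) * card (cong_pairs w q S r)"
proof -
  have "cong_pairs w q S r = {(X, Y). X \<in> {X. X \<subseteq> S \<and> card X = r} \<and> Y \<in> {X. X \<subseteq> S \<and> card X = r} \<and>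
     (\<forall>i. [(\<Sum>x\<in>X. w x i) = (\<Sum>y\<in>Y. w y i)] (mod int q))}"
    by (auto simp: cong_pairs_def)
  then show ?thesis
    using card_sq_le_residue_collisions[of "{X. X \<subseteq> S \<and> card X = r}" q "\<lambda>X i. \<Sum>x\<in>X. w x i"] assms
    by (simp add: n_subsets)
qed

text \<open>
  An overlapping pair arises from a congruent pair of smaller sets by adding a common point to both,
  since a common summand can be cancelled from a congruence.
\<close>

lemma card_overlapping_cong_pairs_le:
  assumes "finite S"
  shows "card (cong_pairs w q S (Suc r)) \<le>
    card (disjoint_cong_pairs w q S (Suc r)) + card S * card (cong_pairs w q S r)"
proof -
  let ?g = "\<lambda>(z, X, Y). (insert z X, insert z Y)"
  have "cong_pairs w q S (Suc r) \<subseteq> disjoint_cong_pairs w q S (Suc r) \<union> ?g ` (S \<times> cong_pairs w q S r)"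
  proof clarify
    fix X Y
    assume XY: "(X, Y) \<in> cong_pairs w q S (Suc r)" and
      n: "(X, Y) \<notin> ?g ` (S \<times> cong_pairs w q S r)"
    show "(X, Y) \<in> disjoint_cong_pairs w q S (Suc r)"
    proof (rule ccontr)
      assume "\<not> ?thesis"
      then obtain z where z: "z \<in> X" "z \<in> Y" using XY by (auto simp: disjoint_cong_pairs_def)
      have fin: "finite X" "finite Y" using XY finite_subset[OF _ assms] by (auto simp: cong_pairs_def)
      have "[(\<Sum>x\<in>X - {z}. w x i) = (\<Sum>y\<in>Y - {z}. w y i)] (mod int q)" for i
      proof -
        have "[(\<Sum>x\<in>X. w x i) = (\<Sum>y\<in>Y. w y i)] (mod int q)"
          using XY by (simp add: cong_pairs_def)
        then show ?thesis
          unfolding sum.remove[OF fin(1) z(1), of "\<lambda>x. w x i"] sum.remove[OF fin(2) z(2), of "\<lambda>x. w x i"]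
          by (simp add: cong_add_lcancel)
      qed
      then have "(X - {z}, Y - {z}) \<in> cong_pairs w q S r"
        using XY z fin by (auto simp: cong_pairs_def)
      then have "?g (z, X - {z}, Y - {z}) \<in> ?g ` (S \<times> cong_pairs w q S r)"
        using XY z by (intro imageI) (auto simp: cong_pairs_def)
      with n z show False by (auto simp: insert_absorb)
    qed
  qed
  then have "card (cong_pairs w q S (Suc r)) \<le>
      card (disjoint_cong_pairs w q S (Suc r) \<union> ?g ` (S \<times> cong_pairs w q S r))"
    by (intro card_mono) (auto simp: assms finite_cong_pairs finite_disjoint_cong_pairs)
  also have "\<dots> \<le> card (disjoint_cong_pairs w q S (Suc r)) + card (?g ` (S \<times> cong_pairs w q S r))"
    by (rule card_Un_le)
  also have "card (?g ` (S \<times> cong_pairs w q S r)) \<le> card (S \<times> cong_pairs w q S r)"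
    by (rule card_image_le) (simp add: assms finite_cong_pairs)
  finally show ?thesis by (simp add: card_cartesian_product)
qed

text \<open>
  A congruent pair \<open>(X, Y)\<close> can be extended by any congruent pair of points \<open>(x, y)\<close> with \<open>x\<close> outside
  \<open>X\<close> and \<open>y\<close> outside \<open>Y\<close>. At most \<open>2 * r * card S\<close> pairs of points violate this. The number of
  extensions that lead to the same larger pair is at most \<open>(Suc r)\<^sup>2\<close>, because it suffices to know
  which two points were added.
\<close>

lemma card_cong_pairs_extend:
  fixes w :: "'a \<Rightarrow> 'i \<Rightarrow> int" and q :: nat
  assumes "finite S"
  defines "P \<equiv> {(x, y). x \<in> S \<and> y \<in> S \<and> (\<forall>i. [w x i = w y i] (mod int q))}"
  shows "card (cong_pairs w q S r) * (card P - 2 * r * card S) \<le> (Suc r)\<^sup>2 * card (cong_pairs w q S (Suc r))"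
proof -
  have finP: "finite P" by (rule finite_subset[of _ "S \<times> S"]) (auto simp: P_def assms)
  define F where "F = (\<lambda>(X, Y). P - (X \<times> S \<union> S \<times> Y))"
  define A where "A = Sigma (cong_pairs w q S r) F"
  define B where "B = Sigma (cong_pairs w q S (Suc r)) (\<lambda>(X, Y). X \<times> Y)"
  have F: "card P - 2 * r * card S \<le> card (F p)" if "p \<in> cong_pairs w q S r" for p
  proof -
    obtain X Y where p: "p = (X, Y)" by (cases p)
    have X: "finite X" "finite Y" "card X = r" "card Y = r"
      using that finite_subset[OF _ assms(1)] by (auto simp: cong_pairs_def p)
    have "card (X \<times> S \<union> S \<times> Y) \<le> 2 * r * card S"
      using card_Un_le[of "X \<times> S" "S \<times> Y"] X by (simp add: card_cartesian_product algebra_simps)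
    moreover have "card P - card (X \<times> S \<union> S \<times> Y) \<le> card (F p)"
      unfolding F_def p prod.case by (rule diff_card_le_card_Diff) (use X assms in auto)
    ultimately show ?thesis by linarith
  qed
  have finF: "finite (F p)" for p by (cases p) (simp add: F_def finP)
  have finXY: "finite (case p of (X, Y) \<Rightarrow> X \<times> Y)" if "p \<in> cong_pairs w q S (Suc r)" for p
    using that finite_subset[OF _ assms(1)] by (auto simp: cong_pairs_def)
  have "card (cong_pairs w q S r) * (card P - 2 * r * card S) \<le> (\<Sum>p\<in>cong_pairs w q S r. card (F p))"
    using sum_mono[of "cong_pairs w q S r" "\<lambda>_. card P - 2 * r * card S" "\<lambda>p. card (F p)"] F by simp
  also have "\<dots> = card A"
    unfolding A_def by (rule card_SigmaI[symmetric]) (auto simp: assms finite_cong_pairs finF)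
  also have "\<dots> \<le> card B"
  proof (rule card_inj_on_le)
    let ?h = "\<lambda>((X, Y), x, y). ((insert x X, insert y Y), x, y)"
    show "inj_on ?h A"
    proof (rule inj_onI)
      fix p p' assume in_A: "p \<in> A" "p' \<in> A" and eq: "?h p = ?h p'"
      obtain X Y x y X' Y' x' y' where p: "p = ((X, Y), x, y)" "p' = ((X', Y'), x', y')"
        by (metis surj_pair)
      have "x \<notin> X" "y \<notin> Y" "x' \<notin> X'" "y' \<notin> Y'"
        using in_A p by (auto simp: A_def F_def P_def)
      moreover have "x = x'" "y = y'" "insert x X = insert x X'" "insert y Y = insert y Y'"
        using eq p by auto
      ultimately show "p = p'" using p by (metis insert_ident)
    qed
    show "?h ` A \<subseteq> B"
    proof clarify
      fix X Y x y assume a: "((X, Y), x, y) \<in> A"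
      have fin: "finite X" "finite Y" using a finite_subset[OF _ assms(1)] by (auto simp: A_def cong_pairs_def)
      have n: "x \<notin> X" "y \<notin> Y" using a by (auto simp: A_def F_def P_def)
      show "((insert x X, insert y Y), x, y) \<in> B"
        using a fin n by (auto simp: A_def B_def F_def P_def cong_pairs_def intro!: cong_add)
    qed
    show "finite B" unfolding B_def
      using finXY by (intro finite_SigmaI finite_cong_pairs assms(1))
  qed
  also have "\<dots> = (\<Sum>p\<in>cong_pairs w q S (Suc r). card (case p of (X, Y) \<Rightarrow> X \<times> Y))"
    unfolding B_def using finXY by (intro card_SigmaI finite_cong_pairs assms(1)) auto
  also have "\<dots> = (\<Sum>p\<in>cong_pairs w q S (Suc r). (Suc r)\<^sup>2)"
    by (rule sum.cong) (auto simp: cong_pairs_def card_cartesian_product power2_eq_square)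
  finally show ?thesis by (simp add: mult.commute)
qed

text \<open>
  As long as \<open>q ^ CARD('i)\<close> is at most a small constant times \<open>card S\<close>, at least half of the congruent pairs
  are disjoint: the number of congruent pairs grows by at least the factor \<open>2 * card S\<close> when the size
  of the sets is raised from \<open>r - 1\<close> to \<open>r\<close>, whereas the overlapping pairs of \<open>r\<close>-sets exceed all
  congruent pairs of \<open>(r - 1)\<close>-sets by at most the factor \<open>card S\<close>. The total number of congruent
  pairs is bounded below by the pigeonhole principle.
\<close>

lemma card_disjoint_cong_pairs_ge:
  fixes w :: "'a \<Rightarrow> 'i::finite \<Rightarrow> int"
  assumes "finite S" "q > 0" "r \<ge> 1" and large: "(2 * r\<^sup>2 + 2 * r) * q ^ CARD('i) \<le> card S"
  shows "card S ^ (2 * r) \<le> 2 * r ^ (2 * r) * q ^ CARD('i) * card (disjoint_cong_pairs w q S r)"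
proof -
  obtain s where r: "r = Suc s" using assms(3) by (cases r) auto
  define N where "N = card S"
  define m where "m = q ^ CARD('i)"
  have m: "m > 0" using assms by (simp add: m_def)
  define P where "P = {(x, y). x \<in> S \<and> y \<in> S \<and> (\<forall>i. [w x i = w y i] (mod int q))}"
  let ?U = "\<lambda>r. card (cong_pairs w q S r)"
  let ?T = "card (disjoint_cong_pairs w q S r)"
  \<comment> \<open>Pigeonhole for single points: there are far more congruent pairs of points than points.\<close>
  have "N\<^sup>2 \<le> m * card P"
    unfolding N_def m_def P_def using card_sq_le_residue_collisions assms(1,2) .
  moreover have "m * ((2 * r\<^sup>2 + 2 * r) * N) \<le> N\<^sup>2"
    using large mult_right_mono[of "(2 * r\<^sup>2 + 2 * r) * m" N N] by (simp add: N_def m_def power2_eq_square mult_ac)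
  ultimately have "m * ((2 * r\<^sup>2 + 2 * r) * N) \<le> m * card P" by linarith
  then have "(2 * r\<^sup>2 + 2 * r) * N \<le> card P" using m by simp
  then have "2 * r\<^sup>2 * N \<le> card P - 2 * s * N" by (simp add: r algebra_simps)
  then have "?U s * (2 * r\<^sup>2 * N) \<le> ?U s * (card P - 2 * s * N)" by (rule mult_left_mono) simp
  also have "\<dots> \<le> r\<^sup>2 * ?U r"
    unfolding P_def N_def r by (rule card_cong_pairs_extend[OF assms(1)])
  finally have "r\<^sup>2 * (2 * (N * ?U s)) \<le> r\<^sup>2 * ?U r" by (simp add: mult_ac)
  then have "2 * (N * ?U s) \<le> ?U r" using assms(3) by simp
  moreover have "?U r \<le> ?T + N * ?U s"
    unfolding r N_def by (rule card_overlapping_cong_pairs_le[OF assms(1)])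
  ultimately have UT: "?U r \<le> 2 * ?T" by linarith
  have "1 \<le> m" using m by simp
  then have "1 * r \<le> m * (2 * r\<^sup>2 + 2 * r)" by (rule mult_mono) auto
  then have "r \<le> N" using large by (simp add: N_def m_def mult_ac)
  then have "(real N / real r) ^ r \<le> real (N choose r)"
    by (rule binomial_ge_n_over_k_pow_k)
  then have "real N ^ r \<le> real r ^ r * real (N choose r)"
    using assms(3) by (simp add: power_divide field_simps)
  then have "N ^ r \<le> r ^ r * (N choose r)"
    by (metis of_nat_le_iff of_nat_mult of_nat_power)
  then have "(N ^ r)\<^sup>2 \<le> (r ^ r * (N choose r))\<^sup>2" by (rule power_mono) simp
  also have "\<dots> = r ^ (2 * r) * (N choose r)\<^sup>2" by (simp add: power_mult_distrib power_mult mult.commute[of 2])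
  also have "\<dots> \<le> r ^ (2 * r) * (m * (2 * ?T))"
    using le_trans[OF card_cong_pairs_ge[OF assms(1,2), of r w, folded m_def N_def] mult_left_mono[OF UT, of m]]
    by (intro mult_left_mono) auto
  finally have "card S ^ (r * 2) \<le> r ^ (2 * r) * (m * (2 * ?T))"
    by (simp only: N_def power_mult)
  then show ?thesis by (simp add: m_def mult_ac)
qed

section \<open>Affine independence and proportional differences\<close>

text \<open>
  A small affinely dependent subset can be enlarged to \<open>k + 2\<close> points of \<open>S\<close>, which are still
  dependent and hence span at most dimension \<open>k\<close>. As \<open>k\<close> does not exceed the dimension of the space,
  their affine hull lies in a flat of dimension exactly \<open>k\<close>, contrary to the hypothesis on \<open>S\<close>.
\<close>

lemma affine_independent_if_no_k_plus_2_on_flat: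
  fixes S :: "(real ^ 'd::finite) set"
  assumes gen: "no_k_plus_2_on_flat k S" and "k \<le> CARD('d)" "finite S" "k + 2 \<le> card S"
    and T: "T \<subseteq> S" "card T \<le> k + 2"
  shows "\<not> affine_dependent T"
proof
  assume dep: "affine_dependent T"
  obtain T' where T': "T \<subseteq> T'" "T' \<subseteq> S" "card T' = k + 2"
    using exists_subset_between[of T "k + 2" S] assms by auto
  have "finite T'" using T' assms(3) finite_subset by blast
  have "affine_dependent T'" using dep T'(1) affine_dependent_subset by blast
  then have "aff_dim T' \<noteq> int (k + 2) - 1"
    using affine_independent_iff_card[of T'] \<open>finite T'\<close> T'(3) by auto
  then have dim: "aff_dim T' \<le> int k"
    using aff_dim_le_card[OF \<open>finite T'\<close>] T'(3) by auto
  \<comment> \<open>A flat of dimension exactly \<open>k\<close>: take an affine basis of \<open>T'\<close>, extend it to the whole space and stop at \<open>k + 1\<close> points.\<close>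
  obtain B where B: "B \<subseteq> T'" "\<not> affine_dependent B" "affine hull T' = affine hull B"
    using affine_basis_exists by blast
  obtain C where C: "\<not> affine_dependent C" "B \<subseteq> C" "affine hull C = (UNIV :: (real ^ 'd) set)"
    using extend_to_affine_basis[OF B(2), of UNIV] by auto
  have "int (card B) = aff_dim T' + 1"
    using aff_dim_affine_independent[OF B(2)] aff_dim_affine_hull B(3) by metis
  with dim have cB: "card B \<le> k + 1" by linarith
  have "int (card C) = int CARD('d) + 1"
    using aff_dim_affine_independent[OF C(1)] aff_dim_affine_hull[of C] C(3) by simp
  then have cC: "k + 1 \<le> card C" "finite C" using assms(2) card.infinite[of C] by fastforce+
  obtain D where D: "B \<subseteq> D" "D \<subseteq> C" "card D = k + 1"
    using exists_subset_between[OF cB cC(1) C(2) cC(2)] by blast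
  have "\<not> affine_dependent D" using C(1) D(2) affine_independent_subset by blast
  then have "aff_dim (affine hull D) = int k"
    using aff_dim_affine_independent[of D] D(3) by simp
  then have "flat k (affine hull D)" by (simp add: flat_def)
  moreover have "T' \<subseteq> affine hull D"
    using hull_subset[of T' affine] hull_mono[OF D(1), of affine] B(3) by blast
  ultimately show False using gen T'(2,3) unfolding no_k_plus_2_on_flat_def by blast
qed

text \<open>
  The proportionality is an affine relation among at most \<open>4 * r\<close> points, so every coefficient in it
  vanishes. At a point of \<open>X\<close> the left-hand side contributes \<open>b\<close>, and the right-hand side can only
  cancel it if the point is in \<open>X'\<close> and \<open>a = b\<close>; points of \<open>Y\<close> behave alike with opposite signs.
\<close>

lemma eq_if_proportional_sum_differences:
  fixes S :: "'v::real_vector set" and a b :: nat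
  assumes indep: "\<And>T. T \<subseteq> S \<Longrightarrow> card T \<le> 4 * r \<Longrightarrow> \<not> affine_dependent T"
    and "finite S" "r \<ge> 1" "a > 0" "b > 0"
    and X: "X \<subseteq> S" "card X = r" and Y: "Y \<subseteq> S" "card Y = r" and "X \<inter> Y = {}"
    and X': "X' \<subseteq> S" "card X' = r" and Y': "Y' \<subseteq> S" "card Y' = r" and "X' \<inter> Y' = {}"
    and proportional: "real b *\<^sub>R (\<Sum>X - \<Sum>Y) = real a *\<^sub>R (\<Sum>X' - \<Sum>Y')"
  shows "a = b \<and> X = X' \<and> Y = Y'"
proof -
  define T where "T = X \<union> Y \<union> X' \<union> Y'"
  define U where "U v = real b * (of_bool (v \<in> X) - of_bool (v \<in> Y))
    - real a * (of_bool (v \<in> X') - of_bool (v \<in> Y'))" for v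
  have finT: "finite T" using X Y X' Y' assms(2) by (auto simp: T_def intro: finite_subset)
  have "card T \<le> card X + card Y + card X' + card Y'"
    unfolding T_def by (meson card_Un_le add_mono le_trans order_refl)
  then have "card T \<le> 4 * r" using X Y X' Y' by simp
  then have "\<not> affine_dependent T" using X Y X' Y' by (intro indep) (auto simp: T_def)
  moreover have ind: "(\<Sum>v\<in>T. of_bool (v \<in> A)) = real (card A)" "(\<Sum>v\<in>T. of_bool (v \<in> A) *\<^sub>R v) = \<Sum>A"
    if "A \<subseteq> T" for A
    using that finT by (auto simp: sum.mono_neutral_cong_right[of T A] Int_absorb1 intro!: sum.mono_neutral_cong_right)
  have sub: "X \<subseteq> T" "Y \<subseteq> T" "X' \<subseteq> T" "Y' \<subseteq> T" by (auto simp: T_def)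
  have "sum U T = 0"
    unfolding U_def by (simp only: sum_subtractf sum_distrib_left[symmetric] ind sub X Y X' Y') simp
  moreover have "(\<Sum>v\<in>T. U v *\<^sub>R v) = 0"
    unfolding U_def
    by (simp only: scaleR_left_diff_distrib scaleR_scaleR[symmetric] sum_subtractf scaleR_sum_right[symmetric] ind sub proportional) simp
  ultimately have zero: "U v = 0" if "v \<in> T" for v
    using affine_dependent_explicit_finite[OF finT] that by blast
  have XX: "v \<in> X' \<and> a = b" if "v \<in> X" for v
  proof -
    have "v \<notin> Y" using that assms by auto
    then show ?thesis using zero[of v] that assms(4,5) sub
      by (cases "v \<in> X'"; cases "v \<in> Y'") (auto simp: U_def)
  qed
  have YY: "v \<in> Y'" if "v \<in> Y" for v
  proof -
    have "v \<notin> X" using that assms by auto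
    then show ?thesis using zero[of v] that assms(4,5) sub
      by (cases "v \<in> X'"; cases "v \<in> Y'") (auto simp: U_def)
  qed
  have fin: "finite X'" "finite Y'" using X' Y' assms(2) by (auto intro: finite_subset)
  have "X = X'" by (rule card_subset_eq[OF fin(1)]) (use XX X X' in auto)
  moreover have "Y = Y'" by (rule card_subset_eq[OF fin(2)]) (use YY Y Y' in auto)
  moreover have "X \<noteq> {}" using X \<open>r \<ge> 1\<close> by auto
  ultimately show ?thesis using XX by blast
qed

section \<open>Counting quotients of differences in a box\<close>

lemma card_grid_le: "card (grid n :: (real ^ 'd::finite) set) \<le> n ^ CARD('d)"
proof -
  have "card (grid n :: (real ^ 'd) set) \<le> card (PiE (UNIV :: 'd set) (\<lambda>_. real ` {1..n}))"
    by (rule card_inj_on_le[of vec_nth]) (auto simp: inj_on_def grid_def vec_eq_iff finite_PiE)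
  then show ?thesis by (simp add: card_PiE card_image)
qed

text \<open>
  To every modulus \<open>q\<close> between \<open>Q\<close> and \<open>2 * Q\<close> and every disjoint pair congruent modulo \<open>q\<close> assign
  the difference of the two sums divided by \<open>q\<close>. This integer vector has entries of absolute value
  at most \<open>r * n / Q\<close>. If two such vectors agree, the differences are proportional, so the pairs and
  the moduli agree as well. Hence the pairs for all \<open>Q\<close> moduli together are at most as many as the
  integer points of a single box, which is where the factor \<open>Q\<close> is gained.
\<close>

lemma card_times_multipliers_le:
  fixes S :: "(real ^ 'd::finite) set"
  assumes grid: "S \<subseteq> grid n"
    and indep: "\<And>T. T \<subseteq> S \<Longrightarrow> card T \<le> 4 * r \<Longrightarrow> \<not> affine_dependent T"
    and "r \<ge> 1" "Q \<ge> 1" "Q \<le> n"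
    and large: "(2 * r\<^sup>2 + 2 * r) * (2 * Q) ^ CARD('d) \<le> card S"
  shows "Q * card S ^ (2 * r) \<le> 2 * r ^ (2 * r) * (2 * (2 * r + 1) * n) ^ CARD('d)"
proof -
  define w :: "real ^ 'd \<Rightarrow> 'd \<Rightarrow> int" where "w x i = \<lfloor>x $ i\<rfloor>" for x i
  define M where "M = r * n div Q"
  let ?d = "CARD('d)"
  let ?T = "\<lambda>q. disjoint_cong_pairs w q S r"
  have fin: "finite S" using grid finite_grid finite_subset by blast
  have w: "real_of_int (w x i) = x $ i" "1 \<le> w x i" "w x i \<le> int n" if x: "x \<in> S" for x i
  proof -
    obtain m where "m \<in> {1..n}" "x $ i = real m" using subsetD[OF grid x] unfolding grid_def by blast
    then show "real_of_int (w x i) = x $ i" "1 \<le> w x i" "w x i \<le> int n" by (auto simp: w_def)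
  qed
  define D where "D X Y i = (\<Sum>x\<in>X. w x i) - (\<Sum>y\<in>Y. w y i)" for X Y i
  have sumw: "0 \<le> (\<Sum>x\<in>X. w x i)" "(\<Sum>x\<in>X. w x i) \<le> int (r * n)" if "X \<subseteq> S" "card X = r" for X i
    using that w(2,3)[of _ i] sum_bounded_above[of X "\<lambda>x. w x i" "int n"]
    by (force intro!: sum_nonneg)+
  have pair: "X \<subseteq> S" "Y \<subseteq> S" "card X = r" "card Y = r" "X \<inter> Y = {}" "int q dvd D X Y i"
    if "(X, Y) \<in> ?T q" for q X Y i
    using that by (auto simp: disjoint_cong_pairs_def cong_pairs_def D_def cong_iff_dvd_diff)
  have D_real: "real_of_int (D X Y i) = (\<Sum>X - \<Sum>Y) $ i" if "X \<subseteq> S" "Y \<subseteq> S" for X Y i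
  proof -
    have "(\<Sum>x\<in>X. real_of_int (w x i)) = (\<Sum>x\<in>X. x $ i)" "(\<Sum>x\<in>Y. real_of_int (w x i)) = (\<Sum>x\<in>Y. x $ i)"
      using that w(1) by (auto intro!: sum.cong)
    then show ?thesis by (simp add: D_def)
  qed
  define \<Phi> where "\<Phi> = (\<lambda>(q, X, Y) i. D X Y i div int q)"
  have "card (Sigma {Q<..2 * Q} ?T) \<le> card (PiE (UNIV :: 'd set) (\<lambda>_. {- int M..int M}))"
  proof (rule card_inj_on_le[of \<Phi>])
    show "inj_on \<Phi> (Sigma {Q<..2 * Q} ?T)"
    proof (rule inj_onI)
      fix t t' assume t: "t \<in> Sigma {Q<..2 * Q} ?T" "t' \<in> Sigma {Q<..2 * Q} ?T" and \<Phi>: "\<Phi> t = \<Phi> t'"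
      obtain a X Y b X' Y' where tt': "t = (a, X, Y)" "t' = (b, X', Y')" by (metis surj_pair)
      have a: "a \<in> {Q<..2 * Q}" and b: "b \<in> {Q<..2 * Q}"
        and p: "(X, Y) \<in> ?T a" and p': "(X', Y') \<in> ?T b"
        and eq: "\<Phi> (a, X, Y) = \<Phi> (b, X', Y')"
        using t \<Phi> tt' by auto
      have "int b * D X Y i = int a * D X' Y' i" for i
      proof -
        have "D X Y i div int a = D X' Y' i div int b" using eq by (auto simp: \<Phi>_def fun_eq_iff)
        then obtain z where "D X Y i = int a * z" "D X' Y' i = int b * z"
          by (metis dvd_mult_div_cancel pair(6)[OF p] pair(6)[OF p'])
        then show ?thesis by simp
      qed
      then have "real b * real_of_int (D X Y i) = real a * real_of_int (D X' Y' i)" for i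
        by (metis of_int_mult of_int_of_nat_eq)
      then have "real b *\<^sub>R (\<Sum>X - \<Sum>Y) = real a *\<^sub>R (\<Sum>X' - \<Sum>Y')"
        using pair[OF p] pair[OF p'] by (simp add: vec_eq_iff D_real)
      then have "a = b \<and> X = X' \<and> Y = Y'"
        using a b assms(3) fin pair[OF p] pair[OF p']
        by (intro eq_if_proportional_sum_differences[OF indep]) auto
      then show "t = t'" using tt' by simp
    qed
    show "\<Phi> ` Sigma {Q<..2 * Q} ?T \<subseteq> PiE UNIV (\<lambda>_. {- int M..int M})"
    proof (intro image_subsetI PiE_I)
      fix t and i :: 'd assume t: "t \<in> Sigma {Q<..2 * Q} ?T"
      obtain q X Y where t_eq: "t = (q, X, Y)" by (metis surj_pair)
      have q: "Q < q" and p: "(X, Y) \<in> ?T q" using t t_eq by auto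
      define z where "z = D X Y i div int q"
      have z: "int q * z = D X Y i" unfolding z_def using pair(6)[OF p] by simp
      have "\<bar>D X Y i\<bar> \<le> int (r * n)"
        using sumw[of X i] sumw[of Y i] pair[OF p] by (auto simp: D_def)
      then have le: "int q * \<bar>z\<bar> \<le> int (r * n)" by (simp flip: z add: abs_mult)
      have "int Q * \<bar>z\<bar> \<le> int q * \<bar>z\<bar>" using q by (intro mult_right_mono) auto
      with le have "int (Q * nat \<bar>z\<bar>) \<le> int (r * n)" by simp
      then have "Q * nat \<bar>z\<bar> \<le> r * n" by (simp only: of_nat_le_iff)
      then have "nat \<bar>z\<bar> \<le> M" unfolding M_def using \<open>Q \<ge> 1\<close>
        by (simp add: less_eq_div_iff_mult_less_eq mult.commute)
      moreover have "\<Phi> t i = z" by (simp add: \<Phi>_def z_def t_eq)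
      ultimately show "\<Phi> t i \<in> {- int M..int M}" by auto
    qed auto
  qed (simp add: finite_PiE)
  also have "\<dots> = (2 * M + 1) ^ ?d"
  proof -
    have "nat (1 + int M + int M) = 2 * M + 1" by linarith
    then show ?thesis by (simp add: card_PiE)
  qed
  finally have count: "(\<Sum>q\<in>{Q<..2 * Q}. card (?T q)) \<le> (2 * M + 1) ^ ?d"
    using card_SigmaI[of "{Q<..2 * Q}" ?T] fin by (simp add: finite_disjoint_cong_pairs)
  have each: "card S ^ (2 * r) \<le> 2 * r ^ (2 * r) * (2 * Q) ^ ?d * card (?T q)" if q: "q \<in> {Q<..2 * Q}" for q
  proof -
    have mono: "q ^ ?d \<le> (2 * Q) ^ ?d" using q by (intro power_mono) auto
    have "(2 * r\<^sup>2 + 2 * r) * q ^ ?d \<le> card S"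
      using mult_left_mono[OF mono, of "2 * r\<^sup>2 + 2 * r"] large by linarith
    then have "card S ^ (2 * r) \<le> 2 * r ^ (2 * r) * q ^ ?d * card (?T q)"
      using fin q assms(3) by (intro card_disjoint_cong_pairs_ge) auto
    also have "\<dots> \<le> 2 * r ^ (2 * r) * (2 * Q) ^ ?d * card (?T q)"
      using mono by (intro mult_right_mono mult_left_mono) auto
    finally show ?thesis .
  qed
  have "Q * card S ^ (2 * r) = (\<Sum>q\<in>{Q<..2 * Q}. card S ^ (2 * r))" by simp
  also have "\<dots> \<le> (\<Sum>q\<in>{Q<..2 * Q}. 2 * r ^ (2 * r) * (2 * Q) ^ ?d * card (?T q))"
    by (rule sum_mono) (rule each)
  also have "\<dots> = 2 * r ^ (2 * r) * (2 * Q) ^ ?d * (\<Sum>q\<in>{Q<..2 * Q}. card (?T q))"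
    by (simp add: sum_distrib_left)
  also have "\<dots> \<le> 2 * r ^ (2 * r) * (2 * Q) ^ ?d * (2 * M + 1) ^ ?d"
    using count by (rule mult_left_mono) simp
  also have "\<dots> = 2 * r ^ (2 * r) * (2 * (2 * (Q * M) + Q)) ^ ?d"
  proof -
    have "2 * (2 * (Q * M) + Q) = 2 * Q * (2 * M + 1)" by (simp add: algebra_simps)
    then show ?thesis by (simp only: power_mult_distrib mult.assoc)
  qed
  also have "\<dots> \<le> 2 * r ^ (2 * r) * (2 * (2 * r + 1) * n) ^ ?d"
  proof (intro mult_left_mono power_mono)
    have "Q * M \<le> r * n" by (simp add: M_def)
    then show "2 * (2 * (Q * M) + Q) \<le> 2 * (2 * r + 1) * n"
      using \<open>Q \<le> n\<close> by (simp add: algebra_simps)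
  qed auto
  finally show ?thesis .
qed

text \<open>
  The number \<open>Q\<close> of moduli is chosen as large as the counting of disjoint pairs permits, which is a
  constant multiple of \<open>card S powr (1 / CARD('d))\<close>.
\<close>

lemma card_powr_le:
  fixes S :: "(real ^ 'd::finite) set"
  assumes grid: "S \<subseteq> grid n"
    and indep: "\<And>T. T \<subseteq> S \<Longrightarrow> card T \<le> 4 * r \<Longrightarrow> \<not> affine_dependent T"
    and "r \<ge> 1" and large: "(4 * (2 * r\<^sup>2 + 2 * r)) ^ CARD('d) \<le> card S"
  shows "real (card S) powr (2 * real r + 1 / real CARD('d)) \<le>
    16 * (2 * (real r)\<^sup>2 + 2 * real r) * real r ^ (2 * r) * (2 * (2 * real r + 1)) ^ CARD('d)
      * real n powr real CARD('d)"
proof -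
  let ?d = "CARD('d)"
  define N where "N = real (card S)"
  define K where "K = 2 * (real r)\<^sup>2 + 2 * real r"
  have "0 \<le> (real r)\<^sup>2" "1 \<le> real r" using \<open>r \<ge> 1\<close> by auto
  then have K: "K \<ge> 1" unfolding K_def by linarith
  have KN: "(4 * K) ^ ?d \<le> N"
    using large[THEN of_nat_mono[where 'a = real]] by (simp add: N_def K_def)
  have "0 < (4 * K) ^ ?d" using K by simp
  then have N: "N > 0" using KN by linarith
  define y where "y = N powr (1 / real ?d)"
  have y: "y ^ ?d = N" "y \<ge> 0" using N by (auto simp: y_def powr_power)
  have y4: "4 * K \<le> y"
    using power_mono_iff[of "4 * K" y ?d] KN y K by simp
  have "card S \<le> n ^ ?d" using card_mono[OF finite_grid grid] card_grid_le[where 'd = 'd] le_trans by blast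
  then have "N \<le> real n ^ ?d" unfolding N_def by (metis of_nat_le_iff of_nat_power)
  then have yn: "y \<le> real n"
    using power_mono_iff[of y "real n" ?d] y by simp
  then have n: "n > 0" using y4 K by linarith
  \<comment> \<open>The factor \<open>4 * K\<close> makes \<open>(2 * Q) ^ ?d\<close> at most \<open>N / K\<close>.\<close>
  define Q where "Q = nat \<lfloor>y / (4 * K)\<rfloor>"
  have t: "1 \<le> y / (4 * K)" using y4 K by (simp add: field_simps)
  have Q: "Q \<ge> 1" "real Q \<le> y / (4 * K)"
    using t unfolding Q_def by linarith+
  have Q2: "y / (4 * K) \<le> 2 * real Q"
    using Q(1) floor_correct[of "y / (4 * K)"] unfolding Q_def by linarith
  have "y / (4 * K) \<le> y" using K y mult_left_mono[of 1 "4 * K" y] by (simp add: field_simps)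
  then have "Q \<le> n" using Q yn by linarith
  have "(2 * real Q) ^ ?d \<le> (y / K) ^ ?d"
    using Q(2) K y by (intro power_mono) (auto simp: field_simps)
  then have "K * (2 * real Q) ^ ?d \<le> K * (N / K ^ ?d)"
    using K y by (intro mult_left_mono) (auto simp: power_divide)
  also have "\<dots> \<le> N"
    using K N self_le_power[of K ?d] by (simp add: field_simps)
  finally have "real ((2 * r\<^sup>2 + 2 * r) * (2 * Q) ^ ?d) \<le> real (card S)"
    by (simp add: N_def K_def)
  then have "(2 * r\<^sup>2 + 2 * r) * (2 * Q) ^ ?d \<le> card S" by (simp only: of_nat_le_iff)
  from card_times_multipliers_le[OF grid indep \<open>r \<ge> 1\<close> Q(1) \<open>Q \<le> n\<close> this]
  have "real (Q * card S ^ (2 * r)) \<le> real (2 * r ^ (2 * r) * (2 * (2 * r + 1) * n) ^ ?d)"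
    by (simp only: of_nat_le_iff)
  then have main: "real Q * N ^ (2 * r) \<le> 2 * real r ^ (2 * r) * (2 * (2 * real r + 1)) ^ ?d * real n ^ ?d"
    by (simp only: N_def of_nat_mult of_nat_power of_nat_add of_nat_numeral of_nat_1 power_mult_distrib mult.assoc)
  \<comment> \<open>The factor \<open>Q\<close> on the left of \<open>main\<close> is worth \<open>y\<close>, the root of \<open>N\<close>, up to the constant \<open>8 * K\<close>.\<close>
  have "N powr (2 * real r + 1 / real ?d) = y * N ^ (2 * r)"
    using N by (simp add: powr_add y_def powr_realpow[symmetric])
  also have "\<dots> \<le> (8 * K * real Q) * N ^ (2 * r)"
    using Q2 K N by (intro mult_right_mono) (auto simp: field_simps)
  also have "\<dots> \<le> 8 * K * (2 * real r ^ (2 * r) * (2 * (2 * real r + 1)) ^ ?d * real n ^ ?d)"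
    unfolding mult.assoc[of "8 * K"] using main K by (intro mult_left_mono) auto
  also have "real n ^ ?d = real n powr real ?d" using n by (simp add: powr_realpow)
  also have "8 * K * (2 * real r ^ (2 * r) * (2 * (2 * real r + 1)) ^ ?d * real n powr real ?d) =
      16 * K * real r ^ (2 * r) * (2 * (2 * real r + 1)) ^ ?d * real n powr real ?d"
    by (simp only: mult.assoc)
  finally show ?thesis by (simp only: N_def K_def)
qed

section \<open>The upper bound for the grid\<close>

theorem theorem1p3:
  fixes k :: nat
  assumes "2 \<le> k" and "k \<le> CARD('d::finite)"
  shows "(\<lambda>n. real (a_num TYPE('d) k n)) \<in>
    O(\<lambda>n. real n powr
        (real CARD('d) / (2 * real_of_int \<lfloor>real (k + 2) / 4\<rfloor>) *
         (1 - 1 / (2 * real_of_int \<lfloor>real (k + 2) / 4\<rfloor> * real CARD('d) + 1))))"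
proof -
  define r where "r = (k + 2) div 4"
  let ?d = "real CARD('d)"
  have "\<lfloor>real (k + 2) / 4\<rfloor> = int r"
    using floor_divide_of_nat_eq[of "k + 2" 4] by (simp add: r_def)
  then have fl: "real_of_int \<lfloor>real (k + 2) / 4\<rfloor> = real r" by simp
  have r: "r \<ge> 1" "4 * r \<le> k + 2" using assms(1) unfolding r_def by linarith+
  \<comment> \<open>The exponent of the theorem is \<open>?d * \<gamma>\<close>, where \<open>\<gamma>\<close> is the reciprocal of \<open>2 * real r + 1 / ?d\<close>.\<close>
  define \<gamma> where "\<gamma> = ?d / (2 * real r * ?d + 1)"
  define e where "e = ?d / (2 * real r) * (1 - 1 / (2 * real r * ?d + 1))"
  have d: "?d > 0" by simp
  have pos: "2 * real r * ?d + 1 > 0" using d r by (simp add: add_nonneg_pos)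
  have "2 * real r + 1 / ?d = (2 * real r * ?d + 1) / ?d" using d by (simp add: add_divide_distrib)
  then have \<gamma>: "(2 * real r + 1 / ?d) * \<gamma> = 1" "\<gamma> > 0"
    using pos d by (auto simp: \<gamma>_def)
  have "1 - 1 / (2 * real r * ?d + 1) = 2 * real r * ?d / (2 * real r * ?d + 1)"
    using pos by (simp add: field_simps)
  then have e: "e = ?d * \<gamma>" using r by (simp add: e_def \<gamma>_def)
  have e0: "e \<ge> 0" using e \<gamma> d by simp
  define A where "A = 16 * (2 * (real r)\<^sup>2 + 2 * real r) * real r ^ (2 * r) * (2 * (2 * real r + 1)) ^ CARD('d)"
  have A: "A \<ge> 0" by (simp add: A_def)
  \<comment> \<open>Below the threshold \<open>L\<close> the cardinality is bounded by a constant, and the exponent is nonnegative.\<close>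
  define L where "L = max (k + 2) ((4 * (2 * r\<^sup>2 + 2 * r)) ^ CARD('d))"
  define c where "c = max (A powr \<gamma>) (real L)"
  have "real (a_num TYPE('d) k n) \<le> c * real n powr e" if n: "n \<ge> 1" for n
  proof -
    obtain S :: "(real ^ 'd) set" where S: "S \<subseteq> grid n" "no_k_plus_2_on_flat k S"
      "a_num TYPE('d) k n = card S"
      using a_num_attained[of k n, where 'd = 'd] by auto
    have fin: "finite S" using S finite_grid finite_subset by blast
    have "real (card S) \<le> c * real n powr e"
    proof (cases "L \<le> card S")
      case True
      have "\<not> affine_dependent T" if "T \<subseteq> S" "card T \<le> 4 * r" for T
        using affine_independent_if_no_k_plus_2_on_flat[OF S(2) assms(2) fin _ that(1)] that r True
        by (simp add: L_def)
      then have "real (card S) powr (2 * real r + 1 / ?d) \<le> A * real n powr ?d"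
        unfolding A_def using True by (intro card_powr_le[OF S(1)] r) (auto simp: L_def)
      then have "(real (card S) powr (2 * real r + 1 / ?d)) powr \<gamma> \<le> (A * real n powr ?d) powr \<gamma>"
        using \<gamma> by (intro powr_mono2) auto
      then have "real (card S) \<le> A powr \<gamma> * real n powr e"
        using A by (simp add: powr_powr \<gamma>(1) powr_mult e)
      also have "\<dots> \<le> c * real n powr e" by (intro mult_right_mono) (auto simp: c_def)
      finally show ?thesis .
    next
      case False
      then have "real (card S) \<le> c * 1" by (simp add: c_def)
      also have "\<dots> \<le> c * real n powr e"
        using n e0 by (intro mult_left_mono ge_one_powr_ge_zero) (auto simp: c_def le_max_iff_disj)
      finally show ?thesis .
    qed
    then show ?thesis using S(3) by simp
  qed
  then have "(\<lambda>n. real (a_num TYPE('d) k n)) \<in> O(\<lambda>n. real n powr e)"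
    by (intro bigoI[of _ c] eventually_mono[OF eventually_ge_at_top[of 1]]) auto
  then show ?thesis unfolding fl e_def .
qed

end
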